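(* Let $\Delta$ be the root system of type $H(a,1)$ with $a>4$. Let $H\in\{U,L\}$, let $j\in\mathbb Z$, and set $\alpha=\alpha^{SH}_j$, $\beta=\alpha^{SH}_{j+1}$, $\gamma=-(\alpha+\beta)$. Then $$p_{\alpha,\beta}=p_{\beta,\alpha}=a-1,\qquad p_{\alpha,\gamma}=p_{\gamma,\alpha}=p_{\beta,\gamma}=p_{\gamma,\beta}=0.$$
   Context: $\Delta$ is the root system of the Kac--Moody algebra with generalized Cartan matrix $H(a,1)=\begin{pmatrix}2&-1\\-a&2\end{pmatrix}$. Simple roots are $\alpha_1,\alpha_2$; simple reflections $w_1(\alpha_1)=-\alpha_1$, $w_1(\alpha_2)=\alpha_2+\alpha_1$, $w_2(\alpha_1)=\alpha_1+a\alpha_2$, $w_2(\alpha_2)=-\alpha_2$; $W=\langle w_1,w_2\rangle$; symmetric bilinear form $(\alpha_1,\alpha_1)=2a$, $(\alpha_1,\alpha_2)=-a$, $(\alpha_2,\alpha_2)=2$. Real roots are $W\alpha_1\cup W\alpha_2$; imaginary roots are the nonzero $\alpha\in\mathbb Z\alpha_1+\mathbb Z\alpha_2$ with $(\alpha,\alpha)\le0$; $\Delta$ is the set of all real and imaginary roots. For $j\in\mathbb Z$: $\alpha^{SU}_j=(w_2w_1)^j\alpha_2$ and $\alpha^{SL}_j=(w_1w_2)^jw_1\alpha_2$. For roots $\mu,\nu$, the $\mu$-root string through $\nu$ is $\nu-p_{\mu,\nu}\mu,\dots,\nu-\mu,\nu,\nu+\mu,\dots,\nu+q_{\mu,\nu}\mu$;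 that is, $p_{\mu,\nu}$ is the largest integer $p\ge0$ with $\nu-p\mu\in\Delta$. *)

theory Defs
  imports "HOL-Library.Product_Plus" "HOL-Algebra.Bij" "HOL-Algebra.Generated_Groups"
begin

text \<open>
  The root lattice of type \<open>H(a,1)\<close> is \<open>int \<times> int\<close> with componentwise addition; the pair
  \<open>(x, y)\<close> stands for \<open>x \<alpha>\<^sub>1 + y \<alpha>\<^sub>2\<close>.
\<close>

type_synonym root_lattice = "int \<times> int"

definition scale :: "int \<Rightarrow> root_lattice \<Rightarrow> root_lattice" (infixr "*\<^sub>Z" 75) where
  "c *\<^sub>Z v = (c * fst v, c * snd v)"

definition \<alpha>1 :: root_lattice where "\<alpha>1 = (1, 0)"
definition \<alpha>2 :: root_lattice where "\<alpha>2 = (0, 1)"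

text \<open>
  The form and the simple reflections are the (bi)linear extensions of their values on the
  simple roots.
\<close>

definition bform :: "int \<Rightarrow> root_lattice \<Rightarrow> root_lattice \<Rightarrow> int" where
  "bform a u v = 2 * a * (fst u * fst v) - a * (fst u * snd v + snd u * fst v) + 2 * (snd u * snd v)"

definition w1 :: "root_lattice \<Rightarrow> root_lattice" where
  "w1 v = fst v *\<^sub>Z (- \<alpha>1) + snd v *\<^sub>Z (\<alpha>2 + \<alpha>1)"

definition w2 :: "int \<Rightarrow> root_lattice \<Rightarrow> root_lattice" where
  "w2 a v = fst v *\<^sub>Z (\<alpha>1 + a *\<^sub>Z \<alpha>2) + snd v *\<^sub>Z (- \<alpha>2)"

abbreviation lattice_perms :: "(root_lattice \<Rightarrow> root_lattice) monoid" where
  "lattice_perms \<equiv> BijGroup UNIV"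

definition weyl_group :: "int \<Rightarrow> (root_lattice \<Rightarrow> root_lattice) set" where
  "weyl_group a = generate lattice_perms {w1, w2 a}"

definition real_roots :: "int \<Rightarrow> root_lattice set" where
  "real_roots a = (\<lambda>w. w \<alpha>1) ` weyl_group a \<union> (\<lambda>w. w \<alpha>2) ` weyl_group a"

definition imaginary_roots :: "int \<Rightarrow> root_lattice set" where
  "imaginary_roots a = {v. v \<noteq> 0 \<and> bform a v v \<le> 0}"

definition roots :: "int \<Rightarrow> root_lattice set" where
  "roots a = real_roots a \<union> imaginary_roots a"

datatype branch = Upper | Lower

fun short_root :: "int \<Rightarrow> branch \<Rightarrow> int \<Rightarrow> root_lattice" where
  "short_root a Upper j = ((w2 a \<otimes>\<^bsub>lattice_perms\<^esub> w1) [^]\<^bsub>lattice_perms\<^esub> j) \<alpha>2"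
| "short_root a Lower j = ((w1 \<otimes>\<^bsub>lattice_perms\<^esub> w2 a) [^]\<^bsub>lattice_perms\<^esub> j) (w1 \<alpha>2)"

text \<open>
  \<open>string_p a \<mu> \<nu>\<close> is \<open>p\<^bsub>\<mu>,\<nu>\<^esub>\<close>. It is meaningful only if the maximum exists; for imaginary \<open>\<mu>\<close>
  the string can be unbounded, and then the value is unspecified.
\<close>

definition string_p :: "int \<Rightarrow> root_lattice \<Rightarrow> root_lattice \<Rightarrow> int" where
  "string_p a \<mu> \<nu> = (GREATEST p. 0 \<le> p \<and> \<nu> - p *\<^sub>Z \<mu> \<in> roots a)"

text \<open>
  Multiplication in \<open>lattice_perms\<close> is composition only for bijections, so the
  group-theoretic definitions above rely on the following two facts.
\<close>

lemma w1_Bij: "w1 \<in> Bij UNIV"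
proof -
  have "w1 (w1 v) = v" for v
    by (cases v) (simp add: w1_def scale_def \<alpha>1_def \<alpha>2_def)
  then show ?thesis
    by (auto simp: Bij_def intro: involuntory_imp_bij)
qed

lemma w2_Bij: "w2 a \<in> Bij UNIV"
proof -
  have "w2 a (w2 a v) = v" for v
    by (cases v) (simp add: w2_def scale_def \<alpha>1_def \<alpha>2_def algebra_simps)
  then show ?thesis
    by (auto simp: Bij_def intro: involuntory_imp_bij)
qed

lemma w2_w1_mult: "w2 a \<otimes>\<^bsub>lattice_perms\<^esub> w1 = w2 a \<circ> w1"
  by (simp add: BijGroup_def w1_Bij w2_Bij compose_def fun_eq_iff)

lemma w1_w2_mult: "w1 \<otimes>\<^bsub>lattice_perms\<^esub> w2 a = w1 \<circ> w2 a"
  by (simp add: BijGroup_def w1_Bij w2_Bij compose_def fun_eq_iff)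

end

theory Submission imports Defs
begin

text \<open>
  The Weyl group acts on the lattice by isometries that permute the roots, so it preserves all
  root strings. Two consecutive short roots \<open>\<alpha>\<close>, \<open>\<beta>\<close> of either branch have the form \<open>w \<alpha>\<^sub>2\<close>,
  \<open>w (w\<^sub>2 w\<^sub>1 \<alpha>\<^sub>2)\<close> with \<open>w\<close> in the Weyl group, namely \<open>w = (w\<^sub>2 w\<^sub>1)\<^sup>j\<close> for the upper branch and
  \<open>w = (w\<^sub>1 w\<^sub>2)\<^sup>j w\<^sub>1\<close> for the lower one. Hence it suffices to treat the single triple
  \<open>\<alpha> = \<alpha>\<^sub>2\<close>, \<open>\<beta> = \<alpha>\<^sub>1 + (a - 1) \<alpha>\<^sub>2\<close>, \<open>\<gamma> = - \<alpha>\<^sub>1 - a \<alpha>\<^sub>2\<close>.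

  For this triple, upper bounds on the strings come from the norm: every root has norm at most
  \<open>2 a\<close>, since imaginary roots have nonpositive norm and real roots inherit the norms \<open>2 a\<close>
  and \<open>2\<close> of the simple roots. As
  \<open>(\<alpha>, \<alpha>) = (\<beta>, \<beta>) = 2\<close> and \<open>(\<alpha>, \<beta>) = a - 2\<close>, the vector \<open>\<beta> - p \<alpha>\<close> has norm
  \<open>2 + 2 p (p - (a - 2))\<close>, which exceeds \<open>2 a\<close> for \<open>p > a - 1\<close> and equals \<open>2 a\<close> for \<open>p = a - 1\<close>.
  As \<open>(\<gamma>, \<gamma>) = 2 a\<close> and \<open>(\<alpha>, \<gamma>) = (\<beta>, \<gamma>) = - a\<close>, subtracting a positive multiple in the
  pairs that involve \<open>\<gamma>\<close> gives a norm above \<open>2 a\<close> at once. The bounds are attained: the extreme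
  vectors are \<open>\<beta> - (a - 1) \<alpha> = \<alpha>\<^sub>1\<close>, its mirror \<open>\<alpha> - (a - 1) \<beta> = (w\<^sub>2 w\<^sub>1)\<^sup>2 \<alpha>\<^sub>1\<close>, and the real
  roots \<open>\<alpha>\<close>, \<open>\<beta>\<close> and \<open>\<gamma> = w\<^sub>2 w\<^sub>1 \<alpha>\<^sub>1\<close> themselves.
\<close>

section \<open>Simple reflections\<close>

lemmas coords = w1_def w2_def scale_def \<alpha>1_def \<alpha>2_def

lemma one_scale: "1 *\<^sub>Z v = v"
  by (simp add: scale_def)

lemma zero_scale: "0 *\<^sub>Z v = 0"
  by (simp add: scale_def zero_prod_def)

lemma neg_scale: "(- c) *\<^sub>Z v = - (c *\<^sub>Z v)"
  by (simp add: scale_def)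

lemma bform_w1: "bform a (w1 u) (w1 v) = bform a u v"
  by (cases u; cases v) (simp add: bform_def coords algebra_simps)

lemma bform_w2: "bform a (w2 a u) (w2 a v) = bform a u v"
  by (cases u; cases v) (simp add: bform_def coords algebra_simps)

section \<open>The Weyl group\<close>

interpretation lattice_perms: group lattice_perms
  by (rule group_BijGroup)

lemma mult_lattice_perms:
  "f \<in> Bij UNIV \<Longrightarrow> g \<in> Bij UNIV \<Longrightarrow> f \<otimes>\<^bsub>lattice_perms\<^esub> g = f \<circ> g"
  by (simp add: BijGroup_def compose_def fun_eq_iff)

lemma weyl_group_subgroup: "subgroup (weyl_group a) lattice_perms"
  unfolding weyl_group_def
  by (rule lattice_perms.generate_is_subgroup) (simp add: BijGroup_def w1_Bij w2_Bij)

lemma weyl_group_Bij: "w \<in> weyl_group a \<Longrightarrow> w \<in> Bij UNIV"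
  using subgroup.mem_carrier[OF weyl_group_subgroup] by (simp add: BijGroup_def)

lemma weyl_group_mult:
  "f \<in> weyl_group a \<Longrightarrow> g \<in> weyl_group a \<Longrightarrow> f \<otimes>\<^bsub>lattice_perms\<^esub> g = f \<circ> g"
  by (simp add: mult_lattice_perms weyl_group_Bij)

lemma weyl_group_comp:
  assumes "f \<in> weyl_group a" "g \<in> weyl_group a"
  shows "f \<circ> g \<in> weyl_group a"
  using subgroup.m_closed[OF weyl_group_subgroup assms] by (simp add: weyl_group_mult[OF assms])

lemma id_in_weyl_group: "id \<in> weyl_group a"
  using subgroup.one_closed[OF weyl_group_subgroup, of a]
  by (simp add: BijGroup_def id_def restrict_def)

lemma w1_in_weyl_group: "w1 \<in> weyl_group a"
  by (simp add: weyl_group_def generate.incl)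

lemma w2_in_weyl_group: "w2 a \<in> weyl_group a"
  by (simp add: weyl_group_def generate.incl)

lemma w1_involution: "w1 (w1 v) = v"
  by (cases v) (simp add: coords)

lemma w2_involution: "w2 a (w2 a v) = v"
  by (cases v) (simp add: coords algebra_simps)

lemma inv_lattice_perms_involution:
  assumes "f \<in> Bij UNIV" and "\<And>v. f (f v) = v"
  shows "inv\<^bsub>lattice_perms\<^esub> f = f"
proof (rule lattice_perms.inv_equality)
  show "f \<otimes>\<^bsub>lattice_perms\<^esub> f = \<one>\<^bsub>lattice_perms\<^esub>"
    unfolding mult_lattice_perms[OF assms(1) assms(1)]
    by (simp add: BijGroup_def fun_eq_iff assms(2))
qed (simp_all add: BijGroup_def assms(1))

text \<open>
  Induction over a generated group asks about the inverses of the generators, too; these are the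
  generators again, because \<open>w\<^sub>1\<close> and \<open>w\<^sub>2\<close> are involutions. Linearity is stated for two-term
  combinations, which cover both \<open>\<nu> - p \<mu>\<close> and \<open>- (\<mu> + \<nu>)\<close>.
\<close>

lemma weyl_group_isometry:
  assumes "w \<in> weyl_group a"
  shows "w (c *\<^sub>Z u + d *\<^sub>Z v) = c *\<^sub>Z w u + d *\<^sub>Z w v \<and> bform a (w u) (w v) = bform a u v"
  using assms unfolding weyl_group_def
proof (induction arbitrary: c d u v rule: generate.induct)
  case one
  then show ?case by (simp add: BijGroup_def)
next
  case (incl f)
  then show ?case
    by (auto simp: bform_w1 bform_w2) (auto simp: coords algebra_simps)
next
  case (inv f)
  then have "inv\<^bsub>lattice_perms\<^esub> f = f"
    using inv_lattice_perms_involution w1_Bij w2_Bij w1_involution w2_involution by blast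
  with inv show ?case
    by (auto simp: bform_w1 bform_w2) (auto simp: coords algebra_simps)
next
  case (eng f g)
  then have "f \<otimes>\<^bsub>lattice_perms\<^esub> g = f \<circ> g"
    using weyl_group_mult[of f a g] by (simp add: weyl_group_def)
  with eng show ?case by simp
qed

lemma weyl_group_inverse:
  assumes "w \<in> weyl_group a"
  obtains w' where "w' \<in> weyl_group a" "\<And>v. w' (w v) = v"
proof
  let ?w' = "inv\<^bsub>lattice_perms\<^esub> w"
  show closed: "?w' \<in> weyl_group a"
    by (rule subgroup.m_inv_closed[OF weyl_group_subgroup assms])
  have "?w' \<otimes>\<^bsub>lattice_perms\<^esub> w = \<one>\<^bsub>lattice_perms\<^esub>"
    by (rule lattice_perms.l_inv[OF subgroup.mem_carrier[OF weyl_group_subgroup assms]])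
  then have "?w' \<circ> w = id"
    by (simp add: weyl_group_mult[OF closed assms]) (simp add: BijGroup_def id_def restrict_def)
  then show "?w' (w v) = v" for v by (metis comp_apply id_apply)
qed

section \<open>Roots and root strings\<close>

lemma roots_weyl_group_closed:
  assumes w: "w \<in> weyl_group a" and v: "v \<in> roots a"
  shows "w v \<in> roots a"
proof (cases "v \<in> real_roots a")
  case True
  have "w (f u) \<in> (\<lambda>w. w u) ` weyl_group a" if "f \<in> weyl_group a" for f u
    by (rule image_eqI[OF _ weyl_group_comp[OF w that]]) simp
  with True show ?thesis unfolding roots_def real_roots_def by blast
next
  case False
  obtain w' where "w' \<in> weyl_group a" and w': "\<And>v. w' (w v) = v"
    using weyl_group_inverse[OF w] by blast
  have "w' 0 = 0"
    using weyl_group_isometry[OF \<open>w' \<in> weyl_group a\<close>, of 0 0 0 0]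
    by (simp add: zero_scale)
  \<comment> \<open>Injectivity keeps the image of an imaginary root nonzero.\<close>
  with w'[of v] have "w v = 0 \<Longrightarrow> v = 0" by simp
  with False v weyl_group_isometry[OF w, of 0 v 0 v] show ?thesis
    by (auto simp: roots_def imaginary_roots_def)
qed

lemma roots_weyl_group_iff:
  assumes "w \<in> weyl_group a"
  shows "w v \<in> roots a \<longleftrightarrow> v \<in> roots a"
  using assms by (metis roots_weyl_group_closed weyl_group_inverse)

lemma string_p_weyl_group:
  assumes "w \<in> weyl_group a"
  shows "string_p a (w \<mu>) (w \<nu>) = string_p a \<mu> \<nu>"
proof -
  have "w \<nu> - p *\<^sub>Z w \<mu> = w (\<nu> - p *\<^sub>Z \<mu>)" for p
    using weyl_group_isometry[OF assms, of 1 \<nu> "- p" \<mu>] by (simp add: one_scale neg_scale)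
  then show ?thesis
    by (simp add: string_p_def roots_weyl_group_iff[OF assms])
qed

lemma roots_norm_le:
  assumes "a \<ge> 1" and "v \<in> roots a"
  shows "bform a v v \<le> 2 * a"
proof -
  have "bform a (w u) (w u) = bform a u u" if "w \<in> weyl_group a" for w u
    using weyl_group_isometry[OF that] by blast
  with assms show ?thesis
    by (auto simp: roots_def real_roots_def imaginary_roots_def)
      (auto simp: bform_def coords)
qed

text \<open>
  A vector of norm above \<open>2 a\<close> is not a root, so it suffices to watch the norm
  \<open>(\<nu> - p \<mu>, \<nu> - p \<mu>)\<close>, expanded as a quadratic polynomial in \<open>p\<close>, beyond the candidate \<open>m\<close>.
\<close>

lemma string_p_eqI:
  assumes "a \<ge> 1" and "0 \<le> m" and "\<nu> - m *\<^sub>Z \<mu> \<in> roots a"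
    and norm: "\<And>p. p > m \<Longrightarrow> bform a \<nu> \<nu> - 2 * p * bform a \<mu> \<nu> + p * p * bform a \<mu> \<mu> > 2 * a"
  shows "string_p a \<mu> \<nu> = m"
  unfolding string_p_def
proof (rule Greatest_equality)
  show "0 \<le> m \<and> \<nu> - m *\<^sub>Z \<mu> \<in> roots a" using assms by simp
next
  fix p assume "0 \<le> p \<and> \<nu> - p *\<^sub>Z \<mu> \<in> roots a"
  then have "bform a (\<nu> - p *\<^sub>Z \<mu>) (\<nu> - p *\<^sub>Z \<mu>) \<le> 2 * a"
    using roots_norm_le[OF \<open>a \<ge> 1\<close>] by blast
  moreover have "bform a (\<nu> - p *\<^sub>Z \<mu>) (\<nu> - p *\<^sub>Z \<mu>)
      = bform a \<nu> \<nu> - 2 * p * bform a \<mu> \<nu> + p * p * bform a \<mu> \<mu>"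
    by (cases \<mu>; cases \<nu>) (simp add: bform_def scale_def algebra_simps)
  ultimately show "p \<le> m" using norm[of p] by linarith
qed

section \<open>Short roots\<close>

text \<open>
  On the upper branch this is just \<open>(w\<^sub>2 w\<^sub>1)\<^sup>j\<^sup>+\<^sup>1 = (w\<^sub>2 w\<^sub>1)\<^sup>j (w\<^sub>2 w\<^sub>1)\<close>. On the lower branch
  regrouping \<open>(w\<^sub>1 w\<^sub>2)\<^sup>j\<^sup>+\<^sup>1 w\<^sub>1 = ((w\<^sub>1 w\<^sub>2)\<^sup>j w\<^sub>1) (w\<^sub>2 w\<^sub>1)\<close> gives the same shape, so both
  branches reduce to the same computation.
\<close>

lemma consecutive_short_roots:
  obtains w where "w \<in> weyl_group a" "short_root a H j = w \<alpha>2"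
    "short_root a H (j + 1) = w (w2 a (w1 \<alpha>2))"
proof -
  have power: "f [^]\<^bsub>lattice_perms\<^esub> j \<in> weyl_group a \<and>
      f [^]\<^bsub>lattice_perms\<^esub> (j + 1) = f [^]\<^bsub>lattice_perms\<^esub> j \<circ> f"
    if f: "f \<in> weyl_group a" for f
  proof
    show pow: "f [^]\<^bsub>lattice_perms\<^esub> j \<in> weyl_group a"
      using lattice_perms.subgroup_int_pow_closed[OF weyl_group_subgroup f] .
    show "f [^]\<^bsub>lattice_perms\<^esub> (j + 1) = f [^]\<^bsub>lattice_perms\<^esub> j \<circ> f"
      using subgroup.mem_carrier[OF weyl_group_subgroup f]
      by (simp add: lattice_perms.int_pow_mult weyl_group_mult[OF pow f, symmetric])
  qed
  show thesis
  proof (cases H)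
    case Upper
    have "w2 a \<circ> w1 \<in> weyl_group a"
      by (intro weyl_group_comp w1_in_weyl_group w2_in_weyl_group)
    from power[OF this] Upper show thesis
      by (intro that[of "(w2 a \<circ> w1) [^]\<^bsub>lattice_perms\<^esub> j"]) (simp_all add: w2_w1_mult)
  next
    case Lower
    have "w1 \<circ> w2 a \<in> weyl_group a"
      by (intro weyl_group_comp w1_in_weyl_group w2_in_weyl_group)
    from power[OF this] Lower show thesis
      by (intro that[of "(w1 \<circ> w2 a) [^]\<^bsub>lattice_perms\<^esub> j \<circ> w1"])
        (simp_all add: w1_w2_mult weyl_group_comp w1_in_weyl_group)
  qed
qed

lemma simple_roots_in_roots: "\<alpha>1 \<in> roots a" "\<alpha>2 \<in> roots a"
  unfolding roots_def real_roots_def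
  using imageI[OF id_in_weyl_group, of "\<lambda>w. w \<alpha>1" a]
    imageI[OF id_in_weyl_group, of "\<lambda>w. w \<alpha>2" a] by simp_all

lemma string_p_base_triple:
  assumes "a \<ge> 1" and \<beta>_eq: "\<beta> = w2 a (w1 \<alpha>2)" and \<gamma>_eq: "\<gamma> = - (\<alpha>2 + \<beta>)"
  shows "string_p a \<alpha>2 \<beta> = a - 1" "string_p a \<beta> \<alpha>2 = a - 1"
    "string_p a \<alpha>2 \<gamma> = 0" "string_p a \<gamma> \<alpha>2 = 0"
    "string_p a \<beta> \<gamma> = 0" "string_p a \<gamma> \<beta> = 0"
proof -
  have \<beta>: "\<beta> = (1, a - 1)" and \<gamma>: "\<gamma> = (- 1, - a)"
    by (simp_all add: \<beta>_eq \<gamma>_eq coords)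
  note w_roots = roots_weyl_group_closed[OF w1_in_weyl_group]
    roots_weyl_group_closed[OF w2_in_weyl_group]
  have "\<gamma> = w2 a (w1 \<alpha>1)" by (simp add: \<gamma> coords)
  then have roots: "\<alpha>2 \<in> roots a" "\<beta> \<in> roots a" "\<gamma> \<in> roots a"
    using w_roots simple_roots_in_roots by (simp_all add: \<beta>_eq)
  have "\<beta> - (a - 1) *\<^sub>Z \<alpha>2 = \<alpha>1"
    by (simp add: \<beta> coords)
  then have ends: "\<beta> - (a - 1) *\<^sub>Z \<alpha>2 \<in> roots a"
    by (simp add: simple_roots_in_roots)
  have "\<alpha>2 - (a - 1) *\<^sub>Z \<beta> = w2 a (w1 (w2 a (w1 \<alpha>1)))"
    by (simp add: \<beta> coords algebra_simps)
  then have ends': "\<alpha>2 - (a - 1) *\<^sub>Z \<beta> \<in> roots a"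
    by (simp add: w_roots simple_roots_in_roots)
  have norms: "bform a \<alpha>2 \<alpha>2 = 2" "bform a \<beta> \<beta> = 2" "bform a \<gamma> \<gamma> = 2 * a"
    "bform a \<alpha>2 \<beta> = a - 2" "bform a \<beta> \<alpha>2 = a - 2"
    "bform a \<alpha>2 \<gamma> = - a" "bform a \<gamma> \<alpha>2 = - a"
    "bform a \<beta> \<gamma> = - a" "bform a \<gamma> \<beta> = - a"
    by (simp_all add: \<beta> \<gamma> bform_def \<alpha>2_def algebra_simps)
  have short_short: "2 - 2 * p * (a - 2) + p * p * 2 > 2 * a" if "p > a - 1" for p
  proof -
    \<comment> \<open>The difference of the two sides factors as \<open>2 (p + 1) (p - (a - 1))\<close>.\<close>
    have "(p + 1) * (p - (a - 1)) > 0" using that \<open>a \<ge> 1\<close> by (intro mult_pos_pos) auto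
    then show ?thesis by (simp add: algebra_simps)
  qed
  have short_long: "2 * a - 2 * p * (- a) + p * p * 2 > 2 * a" if "p > 0" for p
    using that \<open>a \<ge> 1\<close> by (simp add: add_pos_pos)
  have long_short: "2 - 2 * p * (- a) + p * p * (2 * a) > 2 * a" if "p > 0" for p
  proof -
    have "p * a \<ge> 1 * a" using that \<open>a \<ge> 1\<close> by (intro mult_right_mono) auto
    moreover have "p * p * (2 * a) > 0" using that \<open>a \<ge> 1\<close> by simp
    ultimately show ?thesis by (simp add: algebra_simps)
  qed
  show "string_p a \<alpha>2 \<beta> = a - 1"
    by (rule string_p_eqI[OF \<open>a \<ge> 1\<close> _ ends]) (use \<open>a \<ge> 1\<close> short_short in \<open>simp_all add: norms\<close>)
  show "string_p a \<beta> \<alpha>2 = a - 1"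
    by (rule string_p_eqI[OF \<open>a \<ge> 1\<close> _ ends']) (use \<open>a \<ge> 1\<close> short_short in \<open>simp_all add: norms\<close>)
  show "string_p a \<alpha>2 \<gamma> = 0" "string_p a \<beta> \<gamma> = 0"
    by (rule string_p_eqI[OF \<open>a \<ge> 1\<close> order_refl];
      simp only: zero_scale diff_zero roots norms short_long)+
  show "string_p a \<gamma> \<alpha>2 = 0" "string_p a \<gamma> \<beta> = 0"
    by (rule string_p_eqI[OF \<open>a \<ge> 1\<close> order_refl];
      simp only: zero_scale diff_zero roots norms long_short)+
qed

theorem theorem6p3:
  fixes a j :: int and H :: branch and \<alpha> \<beta> \<gamma> :: root_lattice
  assumes "a > 4"
    and "\<alpha> = short_root a H j"
    and "\<beta> = short_root a H (j + 1)"
    and "\<gamma> = - (\<alpha> + \<beta>)"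
  shows "string_p a \<alpha> \<beta> = a - 1 \<and> string_p a \<beta> \<alpha> = a - 1
    \<and> string_p a \<alpha> \<gamma> = 0 \<and> string_p a \<gamma> \<alpha> = 0
    \<and> string_p a \<beta> \<gamma> = 0 \<and> string_p a \<gamma> \<beta> = 0"
proof -
  obtain w where w: "w \<in> weyl_group a"
    and \<alpha>: "\<alpha> = w \<alpha>2" and \<beta>: "\<beta> = w (w2 a (w1 \<alpha>2))"
    using consecutive_short_roots assms(2,3) by metis
  have "\<gamma> = w (- (\<alpha>2 + w2 a (w1 \<alpha>2)))"
    using weyl_group_isometry[OF w, of "- 1" \<alpha>2 "- 1" "w2 a (w1 \<alpha>2)"]
    by (simp add: assms(4) \<alpha> \<beta> one_scale neg_scale)
  with \<open>a > 4\<close> show ?thesis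
    by (simp add: \<alpha> \<beta> string_p_weyl_group[OF w] string_p_base_triple)
qed

end
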